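(* Let $0<\alpha<1$, $c>1$, and let $X=\{X(t)\}_{t\ge0}$ be a $(c^{1/\alpha},c)$-semistable subordinator. Then there exists a constant $\tilde K_5>0$ such that $$\mathbb{P}\left(X(r)\le x\right)\le\exp\left(-\tilde K_5x^{-\frac{\alpha}{1-\alpha}}\right)\quad\text{for all }r\in[1,c]\text{ and }x>0.$$
   Context: A Lévy process is a stochastically continuous process with càdlàg paths and stationary independent increments, starting at $0$ almost surely. A Lévy process $X$ on $\mathbb{R}$ is $(c^{1/\alpha},c)$-semistable if the distribution of $X(1)$ is not concentrated at a single point and $\{X(ct)\}_{t\ge0}$ and $\{c^{1/\alpha}X(t)\}_{t\ge0}$ have the same finite-dimensional distributions. A semistable subordinator is a semistable Lévy process on $\mathbb{R}$ with almost surely increasing (i.e. nondecreasing) sample paths. *)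

theory Defs
  imports "HOL-Probability.Probability"
begin

text \<open>Time runs over \<open>t \<ge> 0\<close>; the values of a process at negative times are unconstrained.\<close>

definition cadlag :: "(real \<Rightarrow> real) \<Rightarrow> bool" where
  "cadlag f \<longleftrightarrow>
     (\<forall>t\<ge>0. continuous (at_right t) f) \<and>
     (\<forall>t>0. \<exists>l. (f \<longlongrightarrow> l) (at_left t))"

locale levy_process = prob_space M
  for M :: "'a measure" and X :: "real \<Rightarrow> 'a \<Rightarrow> real" +
  assumes random_variable_process: "\<And>t. 0 \<le> t \<Longrightarrow> random_variable borel (X t)"
    and stochastically_continuous:
      "\<And>t e. 0 \<le> t \<Longrightarrow> 0 < e \<Longrightarrow>
        ((\<lambda>s. prob {\<omega> \<in> space M. \<bar>X s \<omega> - X t \<omega>\<bar> > e}) \<longlongrightarrow> 0) (at t within {0..})"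
    and cadlag_paths: "\<And>\<omega>. \<omega> \<in> space M \<Longrightarrow> cadlag (\<lambda>t. X t \<omega>)"
    and stationary_increments:
      "\<And>s t. 0 \<le> s \<Longrightarrow> 0 \<le> t \<Longrightarrow>
        distr M borel (\<lambda>\<omega>. X (s + t) \<omega> - X s \<omega>) = distr M borel (\<lambda>\<omega>. X t \<omega> - X 0 \<omega>)"
    and independent_increments:
      "\<And>(n::nat) t. 0 \<le> t 0 \<Longrightarrow> strict_mono_on {..n} t \<Longrightarrow>
        indep_vars (\<lambda>_. borel) (\<lambda>i \<omega>. X (t (Suc i)) \<omega> - X (t i) \<omega>) {..<n}"
    and starts_at_zero: "AE \<omega> in M. X 0 \<omega> = 0"

definition same_fdd ::
  "'a measure \<Rightarrow> (real \<Rightarrow> 'a \<Rightarrow> real) \<Rightarrow> (real \<Rightarrow> 'a \<Rightarrow> real) \<Rightarrow> bool" where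
  "same_fdd M Y Z \<longleftrightarrow>
     (\<forall>(n::nat) t. (\<forall>i<n. 0 \<le> t i) \<longrightarrow>
        distr M (Pi\<^sub>M {..<n} (\<lambda>_. borel)) (\<lambda>\<omega>. \<lambda>i\<in>{..<n}. Y (t i) \<omega>) =
        distr M (Pi\<^sub>M {..<n} (\<lambda>_. borel)) (\<lambda>\<omega>. \<lambda>i\<in>{..<n}. Z (t i) \<omega>))"

text \<open>The parameters \<open>b\<close> and \<open>c\<close> are those of a \<open>(b, c)\<close>-semistable process;
  \<open>b\<close> scales space and \<open>c\<close> scales time.\<close>

locale semistable_process = levy_process M X
  for M :: "'a measure" and X :: "real \<Rightarrow> 'a \<Rightarrow> real" and b c :: real +
  assumes nondegenerate: "\<nexists>a. measure (distr M borel (X 1)) {a} = 1"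
    and semi_selfsimilar: "same_fdd M (\<lambda>t. X (c * t)) (\<lambda>t \<omega>. b * X t \<omega>)"

locale semistable_subordinator = semistable_process M X b c
  for M :: "'a measure" and X :: "real \<Rightarrow> 'a \<Rightarrow> real" and b c :: real +
  assumes nondecreasing_paths: "AE \<omega> in M. mono_on {0..} (\<lambda>t. X t \<omega>)"

end

theory Submission
  imports Defs
begin

text \<open>Stationary independent increments give \<open>E exp (- u X(t)) = exp (- t \<psi>(u))\<close>, and
  semi-selfsimilarity turns into \<open>\<psi>(b u) = c \<psi>(u)\<close> with \<open>b = c powr (1 / \<alpha>)\<close>. As \<open>\<psi>\<close> is
  nondecreasing, \<open>\<psi>(u) \<ge> k u powr \<alpha>\<close> for \<^emph>\<open>all\<close> \<open>u > 0\<close>, and Chernoff's inequality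
  \<open>P(X(1) \<le> x) \<le> exp (u x - k u powr \<alpha>)\<close>, with \<open>u\<close> of the optimal order
  \<open>x powr (- 1 / (1 - \<alpha>))\<close>, yields the bound for small and large \<open>x\<close> alike.\<close>

section \<open>Cauchy's functional equation on the positive half-line\<close>

lemma additive_nonneg_imp_linear:
  fixes g :: "real \<Rightarrow> real"
  assumes add: "\<And>s t. 0 < s \<Longrightarrow> 0 < t \<Longrightarrow> g (s + t) = g s + g t"
    and nonneg: "\<And>t. 0 < t \<Longrightarrow> 0 \<le> g t"
    and t: "0 < t"
  shows "g t = t * g 1"
proof (rule ccontr)
  have mult: "g (real (Suc n) * s) = real (Suc n) * g s" if "0 < s" for n s
  proof (induction n)
    case (Suc n)
    have "g (real (Suc (Suc n)) * s) = g (real (Suc n) * s + s)"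
      by (simp add: algebra_simps)
    also have "\<dots> = g (real (Suc n) * s) + g s"
      using that by (intro add) auto
    finally show ?case
      using Suc by (simp add: algebra_simps)
  qed simp
  have mono: "g s \<le> g r" if "0 < s" "s \<le> r" for s r
    using add[of s "r - s"] nonneg[of "r - s"] that by (cases "s = r") auto
  \<comment> \<open>By monotonicity, \<open>g (n * t)\<close> lies between the values of
    \<open>g\<close> at the two integers around \<open>n * t\<close>, so the error is bounded
    independently of \<open>n\<close>; a large \<open>n\<close> then rules out
    \<open>g t \<noteq> t * g 1\<close>. The premise keeps the lower integer positive, where
    additivity is assumed.\<close>
  have bound: "real n * \<bar>g t - t * g 1\<bar> \<le> 2 * g 1" if n: "1 \<le> real n * t" for n
  proof -
    obtain m where m: "nat \<lfloor>real n * t\<rfloor> = Suc m"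
      using n by (metis One_nat_def le_nat_floor of_nat_1 Suc_le_D)
    have fl: "real (Suc m) \<le> real n * t" "real n * t \<le> real (Suc (Suc m))"
      using n m by linarith+
    obtain k where k: "n = Suc k"
      using n by (cases n) auto
    have "real (Suc m) * g 1 \<le> real n * g t" "real n * g t \<le> real (Suc (Suc m)) * g 1"
      using mono[of "real (Suc m)" "real n * t"] mono[of "real n * t" "real (Suc (Suc m))"]
        mult[of 1 m] mult[of 1 "Suc m"] mult[OF t, of k] fl n k by auto
    moreover have "real (Suc m) * g 1 \<le> real n * t * g 1"
      "real n * t * g 1 \<le> real (Suc (Suc m)) * g 1"
      using fl nonneg[of 1] by (auto intro: mult_right_mono simp del: of_nat_Suc)
    ultimately have "\<bar>real n * g t - real n * t * g 1\<bar> \<le> g 1"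
      by (auto simp: algebra_simps)
    then have "\<bar>real n * (g t - t * g 1)\<bar> \<le> 2 * g 1"
      using nonneg[of 1] by (simp add: algebra_simps)
    then show ?thesis by (simp add: abs_mult)
  qed
  assume "g t \<noteq> t * g 1"
  then have d: "0 < \<bar>g t - t * g 1\<bar>" by simp
  obtain n :: nat where n: "real n > max (1 / t) (2 * g 1 / \<bar>g t - t * g 1\<bar>)"
    using reals_Archimedean2 by blast
  then have "1 \<le> real n * t" "2 * g 1 < real n * \<bar>g t - t * g 1\<bar>"
    using t d by (simp_all add: field_simps)
  with bound[of n] show False by linarith
qed

section \<open>Laplace transforms of nonnegative random variables\<close>

lemma (in prob_space)
  fixes Y :: "'a \<Rightarrow> real"
  assumes Y: "random_variable borel Y" and pos: "AE \<omega> in M. 0 \<le> Y \<omega>" and u: "0 \<le> u"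
  shows integrable_exp_neg: "integrable M (\<lambda>\<omega>. exp (- u * Y \<omega>))"
    and expectation_exp_neg_pos: "0 < expectation (\<lambda>\<omega>. exp (- u * Y \<omega>))"
    and expectation_exp_neg_le_1: "expectation (\<lambda>\<omega>. exp (- u * Y \<omega>)) \<le> 1"
proof -
  show int: "integrable M (\<lambda>\<omega>. exp (- u * Y \<omega>))"
    using Y pos u by (intro integrable_const_bound[where B = 1]) auto
  have "expectation (\<lambda>\<omega>. exp (- u * Y \<omega>)) \<noteq> 0"
  proof
    assume "expectation (\<lambda>\<omega>. exp (- u * Y \<omega>)) = 0"
    then have "AE \<omega> in M. exp (- u * Y \<omega>) = 0"
      using int by (subst (asm) integral_nonneg_eq_0_iff_AE) auto
    then show False by simp
  qed
  then show "0 < expectation (\<lambda>\<omega>. exp (- u * Y \<omega>))"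
    by (intro order_le_neq_trans Bochner_Integration.integral_nonneg) auto
  show "expectation (\<lambda>\<omega>. exp (- u * Y \<omega>)) \<le> 1"
    using pos u by (intro integral_le_const[OF int]) auto
qed

text \<open>Markov's inequality for \<open>exp (- u * Y)\<close>: as \<open>u\<close> is
  nonnegative, \<open>Y \<le> x\<close> forces this variable to be at least
  \<open>exp (- u * x)\<close>.\<close>

lemma (in prob_space) Chernoff_lower_tail:
  fixes Y :: "'a \<Rightarrow> real"
  assumes Y: "random_variable borel Y" and pos: "AE \<omega> in M. 0 \<le> Y \<omega>" and u: "0 \<le> u"
  shows "prob {\<omega> \<in> space M. Y \<omega> \<le> x} \<le> exp (u * x) * expectation (\<lambda>\<omega>. exp (- u * Y \<omega>))"
proof -
  have "prob {\<omega> \<in> space M. Y \<omega> \<le> x} \<le> prob {\<omega> \<in> space M. exp (- u * x) \<le> exp (- u * Y \<omega>)}"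
    using Y u by (intro finite_measure_mono) (auto intro: mult_left_mono)
  also have "\<dots> \<le> expectation (\<lambda>\<omega>. exp (- u * Y \<omega>)) / exp (- u * x)"
    using integrable_exp_neg[OF assms] by (intro integral_Markov_inequality_measure[where A = "{}"]) auto
  finally show ?thesis
    by (simp add: exp_minus field_simps)
qed

section \<open>The Laplace exponent of a subordinator\<close>

locale subordinator = levy_process M X
  for M :: "'a measure" and X :: "real \<Rightarrow> 'a \<Rightarrow> real" +
  assumes mono_paths: "AE \<omega> in M. mono_on {0..} (\<lambda>t. X t \<omega>)"
begin

text \<open>This is the \<psi> of the overview, read off at time 1;
  \<open>laplace_transform_eq\<close> extends it to all positive times.\<close>

definition laplace_exponent :: "real \<Rightarrow> real" where
  "laplace_exponent u = - ln (expectation (\<lambda>\<omega>. exp (- u * X 1 \<omega>)))"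

lemma nonneg_AE: "0 \<le> t \<Longrightarrow> AE \<omega> in M. 0 \<le> X t \<omega>"
  using mono_paths starts_at_zero by eventually_elim (auto dest: mono_onD[where r = 0 and s = t])

text \<open>The exponential factors over the increments on [0, s] and [s, s + t]. Independence
  splits the expectation, and stationarity moves the second increment to [0, t].\<close>

lemma laplace_transform_add:
  assumes s: "0 < s" and t: "0 < t" and u: "0 \<le> u"
  shows "expectation (\<lambda>\<omega>. exp (- u * X (s + t) \<omega>)) =
    expectation (\<lambda>\<omega>. exp (- u * X s \<omega>)) * expectation (\<lambda>\<omega>. exp (- u * X t \<omega>))"
proof -
  have rv [measurable]: "X 0 \<in> borel_measurable M" "X s \<in> borel_measurable M"
    "X t \<in> borel_measurable M" "X (s + t) \<in> borel_measurable M"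
    using s t by (auto intro: random_variable_process)
  \<comment> \<open>Three times 0, s, s + t give two increments. The first one is
    \<open>X s - X 0\<close>; since \<open>X 0\<close> vanishes only almost surely, it is removed by
    almost-everywhere congruence below.\<close>
  define \<tau> where "\<tau> i = (if i = 0 then 0 else if i = 1 then s else s + t)" for i :: nat
  have "strict_mono_on {..2} \<tau>"
    using s t by (auto simp: strict_mono_on_def \<tau>_def)
  moreover have "0 \<le> \<tau> 0" by (simp add: \<tau>_def)
  ultimately have ind: "indep_vars (\<lambda>_. borel) (\<lambda>i \<omega>. X (\<tau> (Suc i)) \<omega> - X (\<tau> i) \<omega>) {..<2}"
    by (rule independent_increments[rotated])
  let ?D = "\<lambda>i \<omega>. exp (- u * (X (\<tau> (Suc i)) \<omega> - X (\<tau> i) \<omega>))"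
  have ind': "indep_vars (\<lambda>_. borel) ?D {..<2}"
    using indep_vars_compose2[OF ind, of "\<lambda>_ z. exp (- u * z)" "\<lambda>_. borel"] by simp
  have incr: "AE \<omega> in M. 0 \<le> X (s + t) \<omega> - X s \<omega>"
    using mono_paths
    by eventually_elim (use s t in \<open>auto dest: mono_onD[where r = s and s = "s + t"]\<close>)
  have incr0: "AE \<omega> in M. 0 \<le> X s \<omega> - X 0 \<omega>"
    using mono_paths
    by eventually_elim (use s in \<open>auto dest: mono_onD[where r = 0 and s = s]\<close>)
  have int: "integrable M (?D i)" if "i \<in> {..<2}" for i
    using that integrable_exp_neg[OF _ incr u] integrable_exp_neg[OF _ incr0 u]
    by (auto simp: \<tau>_def)
  have split: "{..<2} = {0, 1 :: nat}" by auto
  have "expectation (\<lambda>\<omega>. exp (- u * X (s + t) \<omega>)) = expectation (\<lambda>\<omega>. \<Prod>i<2. ?D i \<omega>)"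
    using starts_at_zero
    by (intro integral_cong_AE)
      (auto simp: split \<tau>_def algebra_simps simp flip: exp_add elim!: eventually_mono)
  also have "\<dots> = (\<Prod>i<2. expectation (?D i))"
    by (intro indep_vars_lebesgue_integral ind' int) auto
  also have "\<dots> = expectation (\<lambda>\<omega>. exp (- u * (X s \<omega> - X 0 \<omega>))) *
      expectation (\<lambda>\<omega>. exp (- u * (X (s + t) \<omega> - X s \<omega>)))"
    by (simp add: split \<tau>_def)
  also have "expectation (\<lambda>\<omega>. exp (- u * (X s \<omega> - X 0 \<omega>))) = expectation (\<lambda>\<omega>. exp (- u * X s \<omega>))"
    using starts_at_zero by (intro integral_cong_AE) (auto elim!: eventually_mono)
  \<comment> \<open>Stationarity is an equality of laws, hence the passage to the image measure and
    back.\<close>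
  also have "expectation (\<lambda>\<omega>. exp (- u * (X (s + t) \<omega> - X s \<omega>))) =
      integral\<^sup>L (distr M borel (\<lambda>\<omega>. X (s + t) \<omega> - X s \<omega>)) (\<lambda>z. exp (- u * z))"
    by (subst integral_distr) auto
  also have "\<dots> = integral\<^sup>L (distr M borel (\<lambda>\<omega>. X t \<omega> - X 0 \<omega>)) (\<lambda>z. exp (- u * z))"
    using s t by (simp add: stationary_increments)
  also have "\<dots> = expectation (\<lambda>\<omega>. exp (- u * (X t \<omega> - X 0 \<omega>)))"
    by (subst integral_distr) auto
  also have "\<dots> = expectation (\<lambda>\<omega>. exp (- u * X t \<omega>))"
    using starts_at_zero by (intro integral_cong_AE) (auto elim!: eventually_mono)
  finally show ?thesis .
qed

text \<open>For fixed \<open>u\<close>, minus the logarithm of the transform is additive in time,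
  and nonnegative because the transform lies in (0, 1]; hence it is linear in time.\<close>

lemma laplace_transform_eq:
  assumes t: "0 < t" and u: "0 \<le> u"
  shows "expectation (\<lambda>\<omega>. exp (- u * X t \<omega>)) = exp (- t * laplace_exponent u)"
proof -
  define g where "g t = - ln (expectation (\<lambda>\<omega>. exp (- u * X t \<omega>)))" for t
  note pos = expectation_exp_neg_pos[OF random_variable_process nonneg_AE u]
  note le_1 = expectation_exp_neg_le_1[OF random_variable_process nonneg_AE u]
  have "g t = t * g 1"
  proof (rule additive_nonneg_imp_linear[OF _ _ t])
    show "g (r + s) = g r + g s" if "0 < r" "0 < s" for r s
      using that pos[of r] pos[of s] laplace_transform_add[OF that u]
      by (simp add: g_def ln_mult)
    show "0 \<le> g r" if "0 < r" for r
      using that pos[of r] le_1[of r] by (simp add: g_def)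
  qed
  then have "ln (expectation (\<lambda>\<omega>. exp (- u * X t \<omega>))) = - t * laplace_exponent u"
    by (simp add: g_def laplace_exponent_def)
  then show ?thesis
    using pos[of t] t by (metis exp_ln less_imp_le)
qed

lemma laplace_exponent_mono:
  assumes "0 \<le> u" "u \<le> v"
  shows "laplace_exponent u \<le> laplace_exponent v"
proof -
  note pos = expectation_exp_neg_pos[OF random_variable_process nonneg_AE]
  note int = integrable_exp_neg[OF random_variable_process nonneg_AE]
  have "expectation (\<lambda>\<omega>. exp (- v * X 1 \<omega>)) \<le> expectation (\<lambda>\<omega>. exp (- u * X 1 \<omega>))"
    using nonneg_AE[of 1] assms
    by (intro integral_mono_AE int) (auto elim!: eventually_mono intro: mult_right_mono)
  then show ?thesis
    using pos[of 1 v] pos[of 1 u] assms by (simp add: laplace_exponent_def)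
qed

text \<open>If the transform were 1, the nonnegative variable \<open>1 - exp (- u * X 1)\<close>
  would have mean 0, forcing \<open>X 1 = 0\<close> almost surely.\<close>

lemma laplace_exponent_pos:
  assumes "0 < u" and nontrivial: "prob {\<omega> \<in> space M. X 1 \<omega> = 0} \<noteq> 1"
  shows "0 < laplace_exponent u"
proof -
  have rv [measurable]: "X 1 \<in> borel_measurable M"
    by (intro random_variable_process) auto
  note int = integrable_exp_neg[OF rv nonneg_AE, of u]
  have "expectation (\<lambda>\<omega>. exp (- u * X 1 \<omega>)) \<noteq> 1"
  proof
    assume "expectation (\<lambda>\<omega>. exp (- u * X 1 \<omega>)) = 1"
    then have "expectation (\<lambda>\<omega>. 1 - exp (- u * X 1 \<omega>)) = 0"
      using int assms by (simp add: prob_space)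
    then have "AE \<omega> in M. 1 - exp (- u * X 1 \<omega>) = 0"
      using int assms nonneg_AE[of 1]
      by (subst (asm) integral_nonneg_eq_0_iff_AE) (auto elim!: eventually_mono)
    then have "AE \<omega> in M. X 1 \<omega> = 0"
      using assms by (auto elim!: eventually_mono)
    then have "prob {\<omega> \<in> space M. X 1 \<omega> = 0} = 1"
      by (subst prob_Collect_eq_1) auto
    with nontrivial show False by simp
  qed
  then show ?thesis
    using expectation_exp_neg_le_1[OF rv nonneg_AE, of u]
      expectation_exp_neg_pos[OF rv nonneg_AE, of u] assms
    by (simp add: laplace_exponent_def)
qed

text \<open>Reduces the bound for every r in [1, c] to r = 1.\<close>

lemma prob_le_antimono:
  assumes "0 \<le> s" "s \<le> t"
  shows "prob {\<omega> \<in> space M. X t \<omega> \<le> x} \<le> prob {\<omega> \<in> space M. X s \<omega> \<le> x}"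
proof (rule finite_measure_mono_AE)
  show "{\<omega> \<in> space M. X s \<omega> \<le> x} \<in> events"
    using random_variable_process[of s] assms by measurable
  show "AE \<omega> in M. \<omega> \<in> {\<omega> \<in> space M. X t \<omega> \<le> x} \<longrightarrow> \<omega> \<in> {\<omega> \<in> space M. X s \<omega> \<le> x}"
    using mono_paths
    by eventually_elim (use assms in \<open>auto dest!: mono_onD[where r = s and s = t]\<close>)
qed

end

section \<open>Consequences of semi-selfsimilarity\<close>

sublocale semistable_subordinator \<subseteq> subordinator
  by unfold_locales (rule nondecreasing_paths)

lemma (in semistable_process) distr_scale:
  assumes t: "0 \<le> t" and c: "0 \<le> c"
  shows "distr M borel (X (c * t)) = distr M borel (\<lambda>\<omega>. b * X t \<omega>)"
proof -
  let ?P = "Pi\<^sub>M {..<1::nat} (\<lambda>_. borel :: real measure)"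
  \<comment> \<open>The equality of finite-dimensional laws is used for a single time; the
    coordinate map turns laws on the one-fold product into laws on the reals.\<close>
  have proj: "distr (distr M ?P (\<lambda>\<omega>. \<lambda>i\<in>{..<1}. Y \<omega>)) borel (\<lambda>f. f 0) = distr M borel Y"
    if "Y \<in> borel_measurable M" for Y :: "'a \<Rightarrow> real"
    using that by (subst distr_distr) (auto simp: o_def)
  have rv: "X t \<in> borel_measurable M" "X (c * t) \<in> borel_measurable M"
    using t c by (auto intro: random_variable_process)
  have "distr M ?P (\<lambda>\<omega>. \<lambda>i\<in>{..<1}. X (c * t) \<omega>) = distr M ?P (\<lambda>\<omega>. \<lambda>i\<in>{..<1}. b * X t \<omega>)"
    using semi_selfsimilar t unfolding same_fdd_def by (elim allE[of _ 1] allE[of _ "\<lambda>_. t"]) simp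
  then show ?thesis
    using proj[OF rv(2)] proj[of "\<lambda>\<omega>. b * X t \<omega>"] rv by simp
qed

lemma (in semistable_process) not_AE_zero: "prob {\<omega> \<in> space M. X 1 \<omega> = 0} \<noteq> 1"
proof -
  have "X 1 \<in> borel_measurable M" by (intro random_variable_process) auto
  then have "measure (distr M borel (X 1)) {0} = prob {\<omega> \<in> space M. X 1 \<omega> = 0}"
    by (subst measure_distr) (auto intro!: arg_cong[where f = prob])
  with nondegenerate show ?thesis by metis
qed

context semistable_subordinator
begin

text \<open>Both sides come from the transform of \<open>X c\<close> at \<open>u\<close>: by
  linearity in time, and by the equality in law of \<open>X c\<close> and
  \<open>b * X 1\<close>.\<close>

lemma laplace_exponent_scale:
  assumes u: "0 \<le> u" and b: "0 \<le> b" and c: "0 < c"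
  shows "laplace_exponent (b * u) = c * laplace_exponent u"
proof -
  have [measurable]: "X 1 \<in> borel_measurable M" "X c \<in> borel_measurable M"
    using c by (auto intro: random_variable_process)
  have "exp (- laplace_exponent (b * u)) = expectation (\<lambda>\<omega>. exp (- u * (b * X 1 \<omega>)))"
    using laplace_transform_eq[of 1 "b * u"] u b by (simp add: mult_ac)
  also have "\<dots> = integral\<^sup>L (distr M borel (\<lambda>\<omega>. b * X 1 \<omega>)) (\<lambda>z. exp (- u * z))"
    by (subst integral_distr) auto
  also have "\<dots> = integral\<^sup>L (distr M borel (X c)) (\<lambda>z. exp (- u * z))"
    using distr_scale[of 1] c by simp
  also have "\<dots> = expectation (\<lambda>\<omega>. exp (- u * X c \<omega>))"
    by (subst integral_distr) auto
  also have "\<dots> = exp (- c * laplace_exponent u)"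
    using laplace_transform_eq[OF c u] .
  finally show ?thesis by simp
qed

lemma laplace_exponent_scale_int:
  assumes b: "0 < b" and c: "0 < c"
  shows "laplace_exponent (b powi n) = c powi n * laplace_exponent 1"
proof -
  have scale: "laplace_exponent (b ^ k * u) = c ^ k * laplace_exponent u" if "0 \<le> u" for k u
    using that laplace_exponent_scale[of "b ^ _ * u"] b c by (induction k) (auto simp: mult.assoc)
  show ?thesis
  proof (cases "0 \<le> n")
    case True
    with scale[of 1 "nat n"] show ?thesis by (simp add: power_int_def)
  next
    case False
    \<comment> \<open>For negative \<open>n\<close>, scaling up from \<open>b powi n\<close> by
      \<open>- n\<close> steps returns to the point 1.\<close>
    with scale[of "b powi n" "nat (- n)"] b c show ?thesis
      by (simp add: power_int_def field_simps)
  qed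
qed

text \<open>Since b to the power \<alpha> is c, the ratio of \<psi>(u) to
  \<open>u powr \<alpha>\<close> is constant along integer powers of \<open>b\<close>. Between them
  monotonicity of \<psi> is used: rounding \<open>u\<close> down to such a power costs at most a
  factor \<open>c\<close>, whence the division by \<open>c\<close>.\<close>

lemma laplace_exponent_ge_powr:
  assumes c: "1 < c" and b: "b = c powr (1 / \<alpha>)" and \<alpha>: "0 < \<alpha>" and u: "0 < u"
  shows "laplace_exponent 1 / c * u powr \<alpha> \<le> laplace_exponent u"
proof -
  have b1: "1 < b"
    using c \<alpha> unfolding b by (intro gr_one_powr) auto
  define n where "n = \<lfloor>log b u\<rfloor>"
  have "b powi n \<le> u"
    using b1 u by (simp add: n_def powr_real_of_int' [symmetric] flip: le_log_iff)
  then have "laplace_exponent (b powi n) \<le> laplace_exponent u"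
    using b1 by (intro laplace_exponent_mono) auto
  then have le: "c powi n * laplace_exponent 1 \<le> laplace_exponent u"
    using laplace_exponent_scale_int[of n] b1 c by simp
  have "u powr \<alpha> = (b powr log b u) powr \<alpha>"
    using b1 u by simp
  also have "\<dots> = c powr log b u"
    using \<alpha> c by (simp add: b powr_powr)
  also have "\<dots> \<le> c powr (real_of_int n + 1)"
    unfolding n_def using c by (intro powr_mono) linarith+
  also have "\<dots> = c * c powi n"
    using c by (simp add: powr_add powr_real_of_int')
  finally have "u powr \<alpha> / c * laplace_exponent 1 \<le> c powi n * laplace_exponent 1"
    using c laplace_exponent_pos[OF _ not_AE_zero, of 1]
    by (intro mult_right_mono) (auto simp: field_simps)
  with le show ?thesis by (simp add: mult_ac)
qed

end

section \<open>Choice of the parameter in Chernoff's bound\<close>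

theorem theorem2p3:
  fixes M :: "'a measure" and X :: "real \<Rightarrow> 'a \<Rightarrow> real" and \<alpha> c :: real
  assumes "0 < \<alpha>" and "\<alpha> < 1" and "1 < c"
    and "semistable_subordinator M X (c powr (1 / \<alpha>)) c"
  shows "\<exists>K>0. \<forall>r\<in>{1..c}. \<forall>x>0.
    measure M {\<omega> \<in> space M. X r \<omega> \<le> x} \<le> exp (- K * x powr (- (\<alpha> / (1 - \<alpha>))))"
proof -
  interpret semistable_subordinator M X "c powr (1 / \<alpha>)" c by fact
  define k where "k = laplace_exponent 1 / c"
  have k: "0 < k"
    using laplace_exponent_pos[OF _ not_AE_zero, of 1] assms by (simp add: k_def)
  \<comment> \<open>Chosen so that \<open>K * x powr (- (\<alpha> / (1 - \<alpha>)))\<close> equals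
    \<open>k / 2 * u powr \<alpha>\<close> for the \<open>u\<close> picked below.\<close>
  define K where "K = k / 2 * (k / 2) powr (\<alpha> / (1 - \<alpha>))"
  have "0 < K" using k by (simp add: K_def)
  moreover have "prob {\<omega> \<in> space M. X r \<omega> \<le> x} \<le> exp (- K * x powr (- (\<alpha> / (1 - \<alpha>))))"
    if r: "r \<in> {1..c}" and x: "0 < x" for r x
  proof -
    \<comment> \<open>The solution of \<open>u * x = k / 2 * u powr \<alpha>\<close>: the growing
      term cancels exactly half of the decay. The exact minimiser of the exponent has
      \<open>\<alpha> * k\<close> in place of \<open>k / 2\<close>, which changes only the
      constant.\<close>
    define u where "u = (k / (2 * x)) powr (1 / (1 - \<alpha>))"
    have u: "0 < u" using k x by (simp add: u_def)
    have "u powr (1 - \<alpha>) = k / (2 * x)"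
      using k x assms by (simp add: u_def powr_powr)
    moreover have "u = u powr (1 - \<alpha>) * u powr \<alpha>"
      using u by (simp flip: powr_add)
    ultimately have ux: "u * x = k / 2 * u powr \<alpha>"
      using x by (metis (no_types, lifting) mult.commute mult.assoc divide_divide_eq_left
        nonzero_mult_div_cancel_left less_irrefl times_divide_eq_left)
    have "u powr \<alpha> = (k / 2 / x) powr (\<alpha> / (1 - \<alpha>))"
      by (simp add: u_def powr_powr)
    also have "\<dots> = (k / 2) powr (\<alpha> / (1 - \<alpha>)) * x powr (- (\<alpha> / (1 - \<alpha>)))"
      using k x by (subst powr_divide) (auto simp: powr_minus_divide)
    finally have K: "k / 2 * u powr \<alpha> = K * x powr (- (\<alpha> / (1 - \<alpha>)))"
      by (simp add: K_def)
    have "prob {\<omega> \<in> space M. X r \<omega> \<le> x} \<le> prob {\<omega> \<in> space M. X 1 \<omega> \<le> x}"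
      using r by (intro prob_le_antimono) auto
    also have "\<dots> \<le> exp (u * x) * expectation (\<lambda>\<omega>. exp (- u * X 1 \<omega>))"
      using u by (intro Chernoff_lower_tail random_variable_process nonneg_AE) auto
    also have "\<dots> = exp (u * x - laplace_exponent u)"
      using laplace_transform_eq[of 1 u] u by (simp flip: exp_add)
    also have "\<dots> \<le> exp (k / 2 * u powr \<alpha> - k * u powr \<alpha>)"
      using laplace_exponent_ge_powr[OF _ refl, of u] assms u by (simp add: ux flip: k_def)
    also have "\<dots> = exp (- K * x powr (- (\<alpha> / (1 - \<alpha>))))"
      using K by simp
    finally show ?thesis .
  qed
  ultimately show ?thesis by blast
qed

end
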